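(* There is an absolute constant $K>0$ such that the following holds. Let $\mathcal{C}\subset\mathbb{R}^n$ be a nonempty compact convex set, $x^*\in\mathcal{C}$, $p\in[2,+\infty)$, $\epsilon>0$, let $D_p=\max_{x,y\in\mathcal{C}}\|y-x\|_p$, and let $f(x)=\frac12\|x-x^*\|_p^2$ for $x\in\mathbb{R}^n$. Run the Frank-Wolfe algorithm on $\min_{x\in\mathcal{C}}f(x)$, started at an arbitrary vertex of $\mathcal{C}$, with either the closed-loop step-size strategy or the open-loop step-size strategy. Then (for each of these two strategies) the algorithm produces an iterate $x\in\mathcal{C}$ satisfying $\|x-x^*\|_p\leq\epsilon$ whose cardinality is $\mathcal{O}(pD_p^2/\epsilon^2)$, i.e. at most $K\max\{1,pD_p^2/\epsilon^2\}$.
   Context: $\|\cdot\|_p$ is the $\ell_p$-norm on $\mathbb{R}^n$ and $\langle\cdot,\cdot\rangle$ the Euclidean inner product. Vertices of $\mathcal{C}$ are its extreme points. Frank-Wolfe algorithm (FW) for a differentiable function $f$ over $\mathcal{C}$: start at a vertex $x_0$ of $\mathcal{C}$; for $t=0,1,2,\ldots$ let $v_t$ be a vertex of $\mathcal{C}$ belonging to $\arg\min_{v\in\mathcal{C}}\langle v,\nabla f(x_t)\rangle$, and set $x_{t+1}=x_t+\gamma_t(v_t-x_t)$ with $\gamma_t\in[0,1]$. Here $f$ is differentiable, $\nabla f(x^* )=0$, and for $x\neq x^*$ the $i$-th entry of $\nabla f(x)$ is $\|x-x^*\|_p^{2-p}\operatorname{sign}([x-x^*]_i)|[x-x^*]_i|^{p-1}$.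 Closed-loop strategy: $\gamma_t=\min\left\{\frac{\langle x_t-v_t,\nabla f(x_t)\rangle}{(p-1)\|x_t-v_t\|_p^2},1\right\}$ (if $v_t=x_t$, the value of $\gamma_t$ is irrelevant). Open-loop strategy: $\gamma_t=\frac{2}{t+2}$. Each iterate $x_{t+1}=(1-\gamma_t)x_t+\gamma_tv_t$ comes with an explicit convex decomposition over $x_0,v_0,\ldots,v_t$. The cardinality of an iterate is the number of distinct vertices with positive weight in this decomposition. *)

theory Defs
  imports "HOL-Analysis.Analysis" "HOL-Library.Function_Algebras"
begin

text \<open>
  The constant in the theorem has to be uniform in the dimension, so the dimension \<open>n\<close> must be a
  bound variable and cannot be a type. A vector of $\mathbb{R}^n$ is therefore represented by the
  real sequence that extends it by zero. With the pointwise vector space structure below, the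
  library notions \<^const>\<open>convex\<close> and \<^const>\<open>extreme_point_of\<close> apply; \<^const>\<open>compact\<close> refers to the
  product topology on sequences, which induces the Euclidean topology on each \<open>Rn n\<close>.
\<close>

instantiation "fun" :: (type, real_vector) real_vector
begin

definition scaleR_fun :: "real \<Rightarrow> ('a \<Rightarrow> 'b) \<Rightarrow> 'a \<Rightarrow> 'b"
  where "scaleR_fun r f = (\<lambda>i. r *\<^sub>R f i)"

instance
  by standard (auto simp: scaleR_fun_def fun_eq_iff scaleR_add_right scaleR_add_left)

end

type_synonym vec = "nat \<Rightarrow> real"

definition Rn :: "nat \<Rightarrow> vec set"
  where "Rn n = {x. \<forall>i\<ge>n. x i = 0}"

definition dot :: "nat \<Rightarrow> vec \<Rightarrow> vec \<Rightarrow> real"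
  where "dot n x y = (\<Sum>i<n. x i * y i)"

definition lp_norm :: "nat \<Rightarrow> real \<Rightarrow> vec \<Rightarrow> real"
  where "lp_norm n p x = (\<Sum>i<n. \<bar>x i\<bar> powr p) powr (1 / p)"

definition lp_diameter :: "nat \<Rightarrow> real \<Rightarrow> vec set \<Rightarrow> real"
  where "lp_diameter n p C = (GREATEST d. \<exists>x\<in>C. \<exists>y\<in>C. d = lp_norm n p (y - x))"

text \<open>The gradient as the vector of partial derivatives.\<close>

definition gradient :: "nat \<Rightarrow> (vec \<Rightarrow> real) \<Rightarrow> vec \<Rightarrow> vec"
  where "gradient n f x = (\<lambda>i. if i < n then deriv (\<lambda>t. f (x(i := t))) (x i) else 0)"

definition half_sq_lp_dist :: "nat \<Rightarrow> real \<Rightarrow> vec \<Rightarrow> vec \<Rightarrow> real"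
  where "half_sq_lp_dist n p xs x = 1 / 2 * (lp_norm n p (x - xs))\<^sup>2"

text \<open>
  \<open>fw_run n C f x v \<gamma>\<close>: the iterates \<open>x\<close>, vertices \<open>v\<close> and step sizes \<open>\<gamma>\<close> form a run of the
  Frank-Wolfe algorithm. It is a relation since the initial vertex, and the minimizing vertex in
  case of ties, can be chosen arbitrarily.
\<close>

definition fw_run ::
  "nat \<Rightarrow> vec set \<Rightarrow> (vec \<Rightarrow> real) \<Rightarrow> (nat \<Rightarrow> vec) \<Rightarrow> (nat \<Rightarrow> vec) \<Rightarrow> (nat \<Rightarrow> real) \<Rightarrow> bool"
  where "fw_run n C f x v \<gamma> \<longleftrightarrow>
    x 0 extreme_point_of C \<and>
    (\<forall>t. v t extreme_point_of C \<and>
         (\<forall>w\<in>C. dot n (v t) (gradient n f (x t)) \<le> dot n w (gradient n f (x t))) \<and>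
         \<gamma> t \<in> {0..1} \<and>
         x (Suc t) = x t + \<gamma> t *\<^sub>R (v t - x t))"

definition closed_loop ::
  "nat \<Rightarrow> real \<Rightarrow> (vec \<Rightarrow> real) \<Rightarrow> (nat \<Rightarrow> vec) \<Rightarrow> (nat \<Rightarrow> vec) \<Rightarrow> (nat \<Rightarrow> real) \<Rightarrow> bool"
  where "closed_loop n p f x v \<gamma> \<longleftrightarrow>
    (\<forall>t. v t \<noteq> x t \<longrightarrow>
      \<gamma> t = min (dot n (x t - v t) (gradient n f (x t)) / ((p - 1) * (lp_norm n p (x t - v t))\<^sup>2)) 1)"

definition open_loop :: "(nat \<Rightarrow> real) \<Rightarrow> bool"
  where "open_loop \<gamma> \<longleftrightarrow> (\<forall>t. \<gamma> t = 2 / (real t + 2))"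

text \<open>
  \<open>fw_weight x0 v \<gamma> t u\<close> is the total weight of the vertex \<open>u\<close> in the convex decomposition of the
  \<open>t\<close>-th iterate obtained by unfolding \<open>x (Suc t) = (1 - \<gamma> t) x t + \<gamma> t v t\<close> down to \<open>x0\<close>; repeated
  occurrences of a vertex are merged.
\<close>

primrec fw_weight :: "vec \<Rightarrow> (nat \<Rightarrow> vec) \<Rightarrow> (nat \<Rightarrow> real) \<Rightarrow> nat \<Rightarrow> vec \<Rightarrow> real"
  where
    "fw_weight x0 v \<gamma> 0 = (\<lambda>u. if u = x0 then 1 else 0)"
  | "fw_weight x0 v \<gamma> (Suc t) =
       (\<lambda>u. (1 - \<gamma> t) * fw_weight x0 v \<gamma> t u + (if u = v t then \<gamma> t else 0))"

definition fw_cardinality :: "vec \<Rightarrow> (nat \<Rightarrow> vec) \<Rightarrow> (nat \<Rightarrow> real) \<Rightarrow> nat \<Rightarrow> nat"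
  where "fw_cardinality x0 v \<gamma> t = card {u. fw_weight x0 v \<gamma> t u > 0}"

lemma fw_weight_support: "{u. fw_weight x0 v \<gamma> t u \<noteq> 0} \<subseteq> insert x0 (v ` {..<t})"
proof (induction t)
  case (Suc t)
  then show ?case by (auto simp: lessThan_Suc split: if_splits)
qed auto

lemma finite_fw_weight_pos: "finite {u. fw_weight x0 v \<gamma> t u > 0}"
  by (rule finite_subset[of _ "insert x0 (v ` {..<t})"])
     (use fw_weight_support[of x0 v \<gamma> t] in force, simp)

lemma fw_weight_decomposition:
  assumes "fw_run n C f x v \<gamma>" "finite F" "x 0 \<in> F" "v ` {..<t} \<subseteq> F"
  shows "(\<Sum>u\<in>F. fw_weight (x 0) v \<gamma> t u) = 1"
    and "x t = (\<Sum>u\<in>F. fw_weight (x 0) v \<gamma> t u *\<^sub>R u)"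
proof -
  have "(\<Sum>u\<in>F. fw_weight (x 0) v \<gamma> t u) = 1 \<and> x t = (\<Sum>u\<in>F. fw_weight (x 0) v \<gamma> t u *\<^sub>R u)"
    using assms(4)
  proof (induction t)
    case 0
    have "(\<Sum>u\<in>F. (if u = x 0 then 1 else 0) *\<^sub>R u) = (\<Sum>u\<in>F. if u = x 0 then u else 0)"
      by (intro sum.cong) auto
    then show ?case using assms(2,3) by simp
  next
    case (Suc t)
    then have vt: "v t \<in> F" and
      IH: "(\<Sum>u\<in>F. fw_weight (x 0) v \<gamma> t u) = 1" "x t = (\<Sum>u\<in>F. fw_weight (x 0) v \<gamma> t u *\<^sub>R u)"
      by (auto simp: lessThan_Suc)
    have "(\<Sum>u\<in>F. fw_weight (x 0) v \<gamma> (Suc t) u *\<^sub>R u)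
        = (\<Sum>u\<in>F. (1 - \<gamma> t) *\<^sub>R (fw_weight (x 0) v \<gamma> t u *\<^sub>R u) + (if u = v t then \<gamma> t *\<^sub>R u else 0))"
      by (intro sum.cong) (auto simp: scaleR_add_left)
    also have "\<dots> = (1 - \<gamma> t) *\<^sub>R x t + \<gamma> t *\<^sub>R v t"
      using assms(2) vt by (simp add: sum.distrib IH(2) scaleR_sum_right)
    also have "\<dots> = x (Suc t)"
      using assms(1) by (simp add: fw_run_def algebra_simps)
    finally show ?case
      using IH(1) assms(2) vt by (simp add: sum.distrib flip: sum_distrib_left)
  qed
  then show "(\<Sum>u\<in>F. fw_weight (x 0) v \<gamma> t u) = 1"
    and "x t = (\<Sum>u\<in>F. fw_weight (x 0) v \<gamma> t u *\<^sub>R u)" by auto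
qed

lemma abs_powr_has_real_derivative:
  fixes p u :: real
  assumes "p \<ge> 2"
  shows "((\<lambda>t. \<bar>t\<bar> powr p) has_real_derivative p * (sgn u * \<bar>u\<bar> powr (p - 1))) (at u)"
proof (cases "u = 0")
  case True
  have "((\<lambda>h::real. \<bar>h\<bar> powr (p - 1)) \<longlongrightarrow> \<bar>0\<bar> powr (p - 1)) (at 0)"
    using assms by (intro tendsto_powr' tendsto_intros) auto
  then have "((\<lambda>h::real. \<bar>h\<bar> powr (p - 1)) \<longlongrightarrow> 0) (at 0)" by simp
  then have "((\<lambda>h::real. \<bar>h\<bar> powr p / h) \<longlongrightarrow> 0) (at 0)"
  proof (rule Lim_null_comparison[rotated])
    show "\<forall>\<^sub>F h::real in at 0. norm (\<bar>h\<bar> powr p / h) \<le> \<bar>h\<bar> powr (p - 1)"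
      by (auto simp: eventually_at_filter powr_diff divide_simps)
  qed
  then show ?thesis using True by (simp add: DERIV_def)
next
  case False
  have "((\<lambda>t. (sgn u * t) powr p) has_real_derivative p * (sgn u * \<bar>u\<bar> powr (p - 1))) (at u)"
    using False by (auto intro!: derivative_eq_intros simp: abs_sgn mult.commute sgn_if)
  moreover have "\<forall>\<^sub>F t in nhds u. t \<in> (if u > 0 then {0<..} else {..<0})"
    using False by (intro eventually_nhds_in_open) auto
  then have "\<forall>\<^sub>F t in nhds u. \<bar>t\<bar> powr p = (sgn u * t) powr p"
    by eventually_elim (use False in \<open>auto split: if_splits\<close>)
  ultimately show ?thesis by (subst DERIV_cong_ev[OF refl _ refl]) auto
qed

text \<open>For the objective at hand, \<^const>\<open>gradient\<close> is given by the usual closed form.\<close>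

lemma gradient_half_sq_lp_dist:
  assumes p: "p \<ge> 2" and i: "i < n"
  shows "gradient n (half_sq_lp_dist n p xs) x i =
    (if \<forall>j<n. x j = xs j then 0
     else lp_norm n p (x - xs) powr (2 - p) * (sgn (x i - xs i) * \<bar>x i - xs i\<bar> powr (p - 1)))"
proof -
  define A where "A = (\<Sum>j\<in>{..<n} - {i}. \<bar>x j - xs j\<bar> powr p)"
  have A0: "A \<ge> 0" by (auto simp: A_def intro: sum_nonneg)
  define S where "S t = A + \<bar>t - xs i\<bar> powr p" for t
  have S: "(\<Sum>j<n. \<bar>(x(i := t) - xs) j\<bar> powr p) = S t" for t
  proof -
    have "(\<Sum>j<n. \<bar>(x(i := t) - xs) j\<bar> powr p)
        = \<bar>(x(i := t) - xs) i\<bar> powr p + (\<Sum>j\<in>{..<n} - {i}. \<bar>(x(i := t) - xs) j\<bar> powr p)"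
      using i by (intro sum.remove) auto
    then show ?thesis by (auto simp: S_def A_def intro!: sum.cong)
  qed
  have f: "half_sq_lp_dist n p xs (x(i := t)) = 1 / 2 * S t powr (2 / p)" for t
  proof -
    have "(S t powr (1 / p))\<^sup>2 = S t powr (2 / p)"
      by (simp add: power2_eq_square flip: powr_add)
    then show ?thesis by (simp only: half_sq_lp_dist_def lp_norm_def S)
  qed
  have Sx: "(\<Sum>j<n. \<bar>(x - xs) j\<bar> powr p) = S (x i)" using S[of "x i"] by simp
  have dS: "(S has_real_derivative p * (sgn (x i - xs i) * \<bar>x i - xs i\<bar> powr (p - 1))) (at (x i))"
  proof -
    have "((\<lambda>t. t - xs i) has_real_derivative 1) (at (x i))"
      by (auto intro!: derivative_eq_intros)
    from DERIV_chain2[where f = "\<lambda>u. \<bar>u\<bar> powr p", OF abs_powr_has_real_derivative[OF p] this]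
    have "((\<lambda>t. \<bar>t - xs i\<bar> powr p) has_real_derivative
        p * (sgn (x i - xs i) * \<bar>x i - xs i\<bar> powr (p - 1))) (at (x i))" by simp
    from DERIV_add[OF DERIV_const[of A] this] show ?thesis by (simp add: S_def[abs_def])
  qed
  show ?thesis
  proof (cases "\<forall>j<n. x j = xs j")
    case True
    have "A = 0" using True by (auto simp: A_def intro!: sum.neutral)
    then have "S t powr (2 / p) = (t - xs i)\<^sup>2" for t
      using p by (cases "t = xs i") (auto simp: S_def powr_powr)
    then have "(\<lambda>t. half_sq_lp_dist n p xs (x(i := t))) = (\<lambda>t. 1 / 2 * (t - xs i)\<^sup>2)"
      using f by auto
    moreover have "((\<lambda>t. 1 / 2 * (t - xs i)\<^sup>2) has_real_derivative 0) (at (x i))"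
      using True i by (auto intro!: derivative_eq_intros)
    ultimately show ?thesis using True i by (simp add: gradient_def DERIV_imp_deriv)
  next
    case False
    then obtain j where j: "j < n" "x j \<noteq> xs j" by auto
    have "0 < \<bar>(x - xs) j\<bar> powr p" using j by simp
    also have "\<dots> \<le> (\<Sum>j<n. \<bar>(x - xs) j\<bar> powr p)"
      using j by (intro member_le_sum) auto
    finally have pos: "S (x i) > 0" by (simp only: Sx)
    have "((\<lambda>t. S t powr (2 / p)) has_real_derivative
        (2 / p) * S (x i) powr (2 / p - 1) * (p * (sgn (x i - xs i) * \<bar>x i - xs i\<bar> powr (p - 1)))) (at (x i))"
      using DERIV_fun_powr[OF dS pos, of "2 / p"] by simp
    from DERIV_cmult[OF this, of "1 / 2"]
    have "deriv (\<lambda>t. half_sq_lp_dist n p xs (x(i := t))) (x i) =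
        S (x i) powr (2 / p - 1) * (sgn (x i - xs i) * \<bar>x i - xs i\<bar> powr (p - 1))"
      using p by (subst f, intro DERIV_imp_deriv) (simp add: field_simps)
    moreover have "lp_norm n p (x - xs) powr (2 - p) = S (x i) powr (2 / p - 1)"
      using p by (simp add: lp_norm_def Sx[simplified] powr_powr diff_divide_distrib)
    ultimately show ?thesis using False i by (simp add: gradient_def)
  qed
qed

end

theory Submission
  imports Defs
begin

text \<open>
  The objective \<open>f x = \<parallel>x - x*\<parallel>\<^sub>p\<^sup>2 / 2\<close> is smooth with constant \<open>p - 1\<close> for the very norm in which
  the error is measured (\<open>half_sq_lp_dist_smooth\<close>); this is why neither the dimension nor more than one factor \<open>p\<close> shows up in the
  bound. Everything else is the classical analysis of Frank-Wolfe.

  Write \<open>h t = f (x t)\<close>, and let the gap \<open>g\<close> be the inner product of \<open>x t - v t\<close> with the gradient.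
  The duality map satisfies \<open>\<langle>z, J z\<rangle> = \<parallel>z\<parallel>\<^sup>2\<close>, so minimality of \<open>v t\<close>, compared with the feasible point
  \<open>x*\<close>, gives \<open>g \<ge> 2 h t\<close>. Smoothness bounds \<open>h (t + 1)\<close> by \<open>h t\<close> plus a
  quadratic in the step size, which the closed-loop step minimizes over the unit interval; hence
  both strategies obey the recursion that the step \<open>2 / (t + 2)\<close> yields
  (\<open>fw_step_decrease\<close>), and \<open>h t \<le> 2 (p - 1) D\<^sup>2 / (t + 2)\<close> for \<open>t \<ge> 1\<close> follows
  (\<open>two_over_t_recursion_bound\<close>). So of the order of \<open>p D\<^sup>2 / \<epsilon>\<^sup>2\<close> steps suffice, and each
  step brings in at most one new vertex (\<open>fw_cardinality_le\<close>).

  For the smoothness, consider \<open>\<phi> t = \<parallel>z + t h\<parallel>\<^sup>2 = S t powr (2 / p)\<close> with \<open>S t = \<Sum>i. \<bar>z i + t h i\<bar> powr p\<close>.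
  Since \<open>2 / p \<le> 1\<close>, the term of \<open>\<phi>''\<close> that contains \<open>(S' t)\<^sup>2\<close> is nonpositive, and Hoelder's
  inequality bounds the term with \<open>S''\<close> by \<open>2 (p - 1) \<parallel>h\<parallel>\<^sup>2\<close>. Taylor's formula then gives the
  claim. Two cases stand apart. If the segment passes through the origin, \<open>S\<close> vanishes there and its
  power need not be differentiable, but then everything is collinear and explicit. For \<open>p = 2\<close>, the
  formula \<open>\<bar>u\<bar> powr (p - 2)\<close> in \<open>S''\<close> fails at \<open>u = 0\<close> by the convention \<open>0 powr 0 = 0\<close>, but the claim is the
  expansion of a square.
\<close>

section \<open>Hoelder's inequality for finite sums\<close>

text \<open>
  Young's inequality, applied to the two families after scaling them to norm one.
\<close>

lemma Holder_inequality_sum: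
  fixes a b :: "'i \<Rightarrow> real"
  assumes "finite I" and pq: "p > 1" "q > 1" "1 / p + 1 / q = 1"
    and nonneg: "\<And>i. i \<in> I \<Longrightarrow> a i \<ge> 0" "\<And>i. i \<in> I \<Longrightarrow> b i \<ge> 0"
  shows "(\<Sum>i\<in>I. a i * b i)
    \<le> (\<Sum>i\<in>I. a i powr p) powr (1 / p) * (\<Sum>i\<in>I. b i powr q) powr (1 / q)"
proof -
  define A where "A = (\<Sum>i\<in>I. a i powr p)"
  define B where "B = (\<Sum>i\<in>I. b i powr q)"
  have "A \<ge> 0" "B \<ge> 0" by (auto simp: A_def B_def intro: sum_nonneg)
  show ?thesis
  proof (cases "A = 0 \<or> B = 0")
    case True
    then have "a i * b i = 0" if "i \<in> I" for i
      using that \<open>finite I\<close> by (auto simp: A_def B_def sum_nonneg_eq_0_iff)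
    then have "(\<Sum>i\<in>I. a i * b i) = 0" by (intro sum.neutral ballI)
    then show ?thesis by simp
  next
    case False
    with \<open>A \<ge> 0\<close> \<open>B \<ge> 0\<close> have pos: "A > 0" "B > 0" by auto
    define \<alpha> \<beta> where "\<alpha> = A powr (1 / p)" and "\<beta> = B powr (1 / q)"
    have ab: "\<alpha> > 0" "\<beta> > 0" "\<alpha> powr p = A" "\<beta> powr q = B"
      using pos pq by (auto simp: \<alpha>_def \<beta>_def powr_powr)
    have "(\<Sum>i\<in>I. (a i / \<alpha>) * (b i / \<beta>))
        \<le> (\<Sum>i\<in>I. (a i / \<alpha>) powr p / p + (b i / \<beta>) powr q / q)"
      using pq nonneg ab by (intro sum_mono Youngs_inequality) auto
    also have "\<dots> = (\<Sum>i\<in>I. a i powr p) / A / p + (\<Sum>i\<in>I. b i powr q) / B / q"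
      using nonneg ab by (simp add: powr_divide sum.distrib sum_divide_distrib)
    also have "\<dots> = 1"
      using pos pq by (simp flip: A_def B_def)
    finally have "(\<Sum>i\<in>I. a i * b i) / (\<alpha> * \<beta>) \<le> 1"
      by (simp add: sum_divide_distrib)
    then show ?thesis
      using ab by (simp add: field_simps flip: A_def B_def \<alpha>_def \<beta>_def)
  qed
qed

section \<open>The norm and its duality map\<close>

text \<open>
  The second derivative of \<open>\<bar>t\<bar> powr p\<close>, up to a factor, with \<open>q = p - 1\<close>. The strict bound on \<open>q\<close>
  matters: for \<open>q = 1\<close> and \<open>u = 0\<close> the right-hand side would be \<open>0 powr 0 = 0\<close>, while the identity
  has derivative \<open>1\<close>. This is what sets the case \<open>p = 2\<close> apart below.
\<close>

lemma sgn_mult_abs_powr_has_real_derivative: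
  fixes q u :: real
  assumes "q > 1"
  shows "((\<lambda>t. sgn t * \<bar>t\<bar> powr q) has_real_derivative q * \<bar>u\<bar> powr (q - 1)) (at u)"
proof (cases "u = 0")
  case True
  have "((\<lambda>h::real. \<bar>h\<bar> powr (q - 1)) \<longlongrightarrow> \<bar>0\<bar> powr (q - 1)) (at 0)"
    using assms by (intro tendsto_powr' tendsto_intros) auto
  then have "((\<lambda>h::real. \<bar>h\<bar> powr (q - 1)) \<longlongrightarrow> 0) (at 0)" by simp
  then have "((\<lambda>h::real. sgn h * \<bar>h\<bar> powr q / h) \<longlongrightarrow> 0) (at 0)"
  proof (rule Lim_null_comparison[rotated])
    show "\<forall>\<^sub>F h::real in at 0. norm (sgn h * \<bar>h\<bar> powr q / h) \<le> \<bar>h\<bar> powr (q - 1)"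
      by (auto simp: eventually_at_filter powr_diff divide_simps abs_mult)
  qed
  then show ?thesis using True by (simp add: DERIV_def)
next
  case False
  have "((\<lambda>t. sgn u * (sgn u * t) powr q) has_real_derivative q * \<bar>u\<bar> powr (q - 1)) (at u)"
    using False by (auto intro!: derivative_eq_intros simp: abs_sgn mult.commute sgn_if)
  moreover have "\<forall>\<^sub>F t in nhds u. t \<in> (if u > 0 then {0<..} else {..<0})"
    using False by (intro eventually_nhds_in_open) auto
  then have "\<forall>\<^sub>F t in nhds u. sgn t * \<bar>t\<bar> powr q = sgn u * (sgn u * t) powr q"
    by eventually_elim (use False in \<open>auto split: if_splits\<close>)
  ultimately show ?thesis by (subst DERIV_cong_ev[OF refl _ refl]) auto
qed

lemma lp_norm_nonneg: "lp_norm n p x \<ge> 0"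
  by (simp add: lp_norm_def)

lemma lp_norm_powr:
  assumes "p > 0"
  shows "lp_norm n p x powr p = (\<Sum>i<n. \<bar>x i\<bar> powr p)"
  using assms by (simp add: lp_norm_def powr_powr sum_nonneg)

lemma lp_norm_square: "(lp_norm n p x)\<^sup>2 = (\<Sum>i<n. \<bar>x i\<bar> powr p) powr (2 / p)"
  by (simp add: lp_norm_def power2_eq_square flip: powr_add)

lemma lp_norm_scaleR:
  assumes "p > 0"
  shows "lp_norm n p (c *\<^sub>R x) = \<bar>c\<bar> * lp_norm n p x"
proof -
  have "(\<Sum>i<n. \<bar>(c *\<^sub>R x) i\<bar> powr p) = \<bar>c\<bar> powr p * (\<Sum>i<n. \<bar>x i\<bar> powr p)"
    by (simp add: scaleR_fun_def abs_mult powr_mult sum_distrib_left)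
  then show ?thesis
    using assms by (simp add: lp_norm_def powr_mult sum_nonneg powr_powr)
qed

lemma lp_norm_eq_0_iff: "lp_norm n p x = 0 \<longleftrightarrow> (\<forall>i<n. x i = 0)"
  by (auto simp: lp_norm_def sum_nonneg_eq_0_iff)

text \<open>
  The gradient of half the squared norm. At \<open>z = 0\<close> the formula gives \<open>0\<close>, as it should, because
  \<open>sgn 0 = 0\<close>.
\<close>

definition lp_duality_map :: "nat \<Rightarrow> real \<Rightarrow> vec \<Rightarrow> vec"
  where "lp_duality_map n p z =
    (\<lambda>i. lp_norm n p z powr (2 - p) * (sgn (z i) * \<bar>z i\<bar> powr (p - 1)))"

lemma dot_lp_duality_map_self:
  assumes "p \<ge> 2"
  shows "dot n z (lp_duality_map n p z) = (lp_norm n p z)\<^sup>2"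
proof (cases "lp_norm n p z = 0")
  case False
  then have pos: "lp_norm n p z > 0" using lp_norm_nonneg[of n p z] by linarith
  have "z i * (sgn (z i) * \<bar>z i\<bar> powr (p - 1)) = \<bar>z i\<bar> powr p" for i
    by (cases "z i = 0") (auto simp: powr_diff sgn_if)
  then have "dot n z (lp_duality_map n p z) = lp_norm n p z powr (2 - p) * lp_norm n p z powr p"
    using assms
    by (simp add: dot_def lp_duality_map_def lp_norm_powr sum_distrib_left
        mult.left_commute[of "z _" "lp_norm n p z powr (2 - p)"])
  also have "\<dots> = (lp_norm n p z)\<^sup>2"
    using pos by (simp flip: powr_add)
  finally show ?thesis .
qed (simp add: dot_def lp_duality_map_def)

section \<open>Smoothness of the squared norm\<close>

text \<open>
  Away from the origin the squared norm is twice differentiable along the segment, and the second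
  derivative there is at most \<open>2 (p - 1) \<parallel>h\<parallel>\<^sup>2\<close>.
\<close>

lemma lp_norm_square_add_le_of_line_nonzero:
  assumes p: "p > 2" and nz: "\<And>t. 0 \<le> t \<Longrightarrow> t \<le> 1 \<Longrightarrow> \<exists>i<n. z i + t * h i \<noteq> 0"
  shows "(lp_norm n p (z + h))\<^sup>2
    \<le> (lp_norm n p z)\<^sup>2 + 2 * dot n h (lp_duality_map n p z) + (p - 1) * (lp_norm n p h)\<^sup>2"
proof -
  \<comment> \<open>Up to the factors \<open>p\<close> and \<open>p - 1\<close>, \<open>S1\<close> and \<open>S2\<close> are the successive derivatives of \<open>S\<close>.\<close>
  define S where "S t = (\<Sum>i<n. \<bar>z i + t * h i\<bar> powr p)" for t
  define S1 where "S1 t = (\<Sum>i<n. h i * (sgn (z i + t * h i) * \<bar>z i + t * h i\<bar> powr (p - 1)))" for t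
  define S2 where "S2 t = (\<Sum>i<n. (h i)\<^sup>2 * \<bar>z i + t * h i\<bar> powr (p - 2))" for t
  have line: "((\<lambda>t. z i + t * h i) has_real_derivative h i) (at t)" for i t
    by (auto intro!: derivative_eq_intros)
  have dS: "(S has_real_derivative p * S1 t) (at t)" for t
  proof -
    have "((\<lambda>t. \<bar>z i + t * h i\<bar> powr p) has_real_derivative
        p * (h i * (sgn (z i + t * h i) * \<bar>z i + t * h i\<bar> powr (p - 1)))) (at t)" for i
      using DERIV_chain2[OF abs_powr_has_real_derivative[of p "z i + t * h i"] line] p
      by (simp add: mult_ac)
    from DERIV_sum[of "{..<n}", OF this] show ?thesis
      by (simp add: S_def[abs_def] S1_def sum_distrib_left)
  qed
  have dS1: "(S1 has_real_derivative (p - 1) * S2 t) (at t)" for t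
  proof -
    have "((\<lambda>t. h i * (sgn (z i + t * h i) * \<bar>z i + t * h i\<bar> powr (p - 1))) has_real_derivative
        (p - 1) * ((h i)\<^sup>2 * \<bar>z i + t * h i\<bar> powr (p - 2))) (at t)" for i
      using DERIV_cmult[OF DERIV_chain2[OF
          sgn_mult_abs_powr_has_real_derivative[of "p - 1" "z i + t * h i"] line], of "h i"] p
      by (simp add: mult_ac power2_eq_square)
    from DERIV_sum[of "{..<n}", OF this] show ?thesis
      by (simp add: S1_def[abs_def] S2_def sum_distrib_left)
  qed
  have S0: "S t \<ge> 0" for t by (simp add: S_def sum_nonneg)
  have Spos: "S t > 0" if "0 \<le> t" "t \<le> 1" for t
    using nz[OF that] S0[of t] by (auto simp: S_def sum_nonneg_eq_0_iff less_le)
  \<comment> \<open>Hoelder's inequality with the conjugate exponents \<open>p / (p - 2)\<close> and \<open>p / 2\<close>.\<close>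
  have S2_le: "S2 t \<le> S t powr (1 - 2 / p) * (lp_norm n p h)\<^sup>2" for t
  proof -
    have "S2 t = (\<Sum>i<n. \<bar>z i + t * h i\<bar> powr (p - 2) * (h i)\<^sup>2)"
      by (simp add: S2_def mult.commute)
    also have "\<dots> \<le> (\<Sum>i<n. (\<bar>z i + t * h i\<bar> powr (p - 2)) powr (p / (p - 2))) powr (1 / (p / (p - 2)))
        * (\<Sum>i<n. ((h i)\<^sup>2) powr (p / 2)) powr (1 / (p / 2))"
      using p by (intro Holder_inequality_sum) (auto simp: field_simps)
    also have "(\<Sum>i<n. (\<bar>z i + t * h i\<bar> powr (p - 2)) powr (p / (p - 2))) = S t"
      using p by (simp add: S_def powr_powr)
    also have "(\<Sum>i<n. ((h i)\<^sup>2) powr (p / 2)) = (\<Sum>i<n. \<bar>h i\<bar> powr p)"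
    proof -
      have "((h i)\<^sup>2) powr (p / 2) = \<bar>h i\<bar> powr p" for i
        using powr_powr[of "\<bar>h i\<bar>" 2 "p / 2"] by simp
      then show ?thesis by simp
    qed
    also have "1 / (p / (p - 2)) = 1 - 2 / p"
      using p by (simp add: field_simps)
    finally show ?thesis by (simp add: lp_norm_square)
  qed
  \<comment> \<open>The function \<open>t \<mapsto> \<parallel>z + t h\<parallel>\<^sup>2\<close> and its first two derivatives, in the form in which
    Taylor's formula wants them.\<close>
  define D where "D m t = (if m = 0 then S t powr (2 / p)
    else if m = 1 then 2 * (S t powr (2 / p - 1) * S1 t)
    else 2 * ((2 / p - 1) * S t powr (2 / p - 2) * (p * S1 t) * S1 t
                 + (p - 1) * S2 t * S t powr (2 / p - 1)))" for m :: nat and t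
  have "\<exists>t. 0 < t \<and> t \<le> 1 \<and>
      D 0 1 = (\<Sum>m<2. D m 0 / fact m * 1 ^ m) + D 2 t / fact 2 * 1 ^ 2"
  proof (rule Maclaurin2, simp_all, intro allI impI, elim conjE)
    fix m :: nat and t :: real assume m: "m < 2" and t: "0 \<le> t" "t \<le> 1"
    have dpow: "((\<lambda>t. S t powr r) has_real_derivative r * S t powr (r - 1) * (p * S1 t)) (at t)" for r
      using DERIV_fun_powr[OF dS Spos[OF t], of r] by simp
    show "(D m has_real_derivative D (Suc m) t) (at t)"
    proof (cases "m = 0")
      case True
      then show ?thesis using dpow[of "2 / p"] p by (simp add: D_def[abs_def] mult_ac)
    next
      case False
      with m have "m = 1" by simp
      then show ?thesis
        using DERIV_cmult[OF DERIV_mult[OF dpow[of "2 / p - 1"] dS1], of 2]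
        by (simp add: D_def[abs_def])
    qed
  qed
  then obtain t where t: "0 < t" "t \<le> 1" and eq: "D 0 1 = D 0 0 + D 1 0 + D 2 t / 2"
    by (auto simp: numeral_2_eq_2)
  have "D 2 t / 2 \<le> (p - 1) * (lp_norm n p h)\<^sup>2"
  proof -
    \<comment> \<open>The outer power \<open>2 / p\<close> is concave, so this part of the second derivative can be dropped.\<close>
    have "(2 / p - 1) * S t powr (2 / p - 2) * (p * S1 t) * S1 t
        = - ((1 - 2 / p) * S t powr (2 / p - 2) * p * (S1 t)\<^sup>2)"
      by (simp add: power2_eq_square algebra_simps)
    also have "\<dots> \<le> 0" using p by simp
    moreover have "D 2 t / 2 = (2 / p - 1) * S t powr (2 / p - 2) * (p * S1 t) * S1 t
        + (p - 1) * S2 t * S t powr (2 / p - 1)"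
      unfolding D_def by simp
    ultimately have "D 2 t / 2 \<le> (p - 1) * S2 t * S t powr (2 / p - 1)"
      by linarith
    also have "\<dots> \<le> (p - 1) * (S t powr (1 - 2 / p) * (lp_norm n p h)\<^sup>2) * S t powr (2 / p - 1)"
      using p S2_le by (intro mult_right_mono mult_left_mono) auto
    also have "\<dots> = (p - 1) * (lp_norm n p h)\<^sup>2 * (S t powr (1 - 2 / p) * S t powr (2 / p - 1))"
      by (simp add: mult_ac)
    also have "S t powr (1 - 2 / p) * S t powr (2 / p - 1) = 1"
      using Spos[of t] t by (simp flip: powr_add)
    finally show ?thesis by simp
  qed
  moreover have "D 0 1 = (lp_norm n p (z + h))\<^sup>2" "D 0 0 = (lp_norm n p z)\<^sup>2"
    by (simp_all add: D_def S_def lp_norm_square)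
  moreover have "D 1 0 = 2 * dot n h (lp_duality_map n p z)"
  proof -
    have "S 0 powr (2 / p - 1) = lp_norm n p z powr (2 - p)"
      using p by (simp add: S_def lp_norm_def powr_powr diff_divide_distrib)
    then show ?thesis
      by (simp add: D_def S1_def dot_def lp_duality_map_def sum_distrib_left mult_ac)
  qed
  ultimately show ?thesis using eq by simp
qed

text \<open>
  If the segment meets the origin at parameter \<open>t\<close>, then \<open>z = - t h\<close>, and both sides are multiples of
  \<open>\<parallel>h\<parallel>\<^sup>2\<close>: the inequality becomes \<open>(1 - t)\<^sup>2 \<le> t\<^sup>2 - 2 t + (p - 1)\<close>.
\<close>

lemma lp_norm_square_add_le_of_line_zero:
  assumes p: "p \<ge> 2" and t: "t \<le> 1" "0 \<le> t" and zero: "\<And>i. i < n \<Longrightarrow> z i + t * h i = 0"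
  shows "(lp_norm n p (z + h))\<^sup>2
    \<le> (lp_norm n p z)\<^sup>2 + 2 * dot n h (lp_duality_map n p z) + (p - 1) * (lp_norm n p h)\<^sup>2"
proof -
  have cong: "lp_norm n p a = lp_norm n p b" if "\<And>i. i < n \<Longrightarrow> a i = b i" for a b
    using that by (simp add: lp_norm_def)
  have z: "z i = - t * h i" if "i < n" for i using zero[OF that] by simp
  have "lp_norm n p z = lp_norm n p ((- t) *\<^sub>R h)"
    by (rule cong) (simp add: z scaleR_fun_def)
  then have nz: "lp_norm n p z = t * lp_norm n p h"
    using p t by (simp add: lp_norm_scaleR del: scaleR_minus_left)
  have "lp_norm n p (z + h) = lp_norm n p ((1 - t) *\<^sub>R h)"
    by (rule cong) (simp add: z scaleR_fun_def algebra_simps)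
  then have nzh: "lp_norm n p (z + h) = (1 - t) * lp_norm n p h"
    using p t by (simp add: lp_norm_scaleR)
  have "dot n h (lp_duality_map n p z) = - t * (lp_norm n p h)\<^sup>2"
  proof (cases "t = 0")
    case True
    then show ?thesis using z by (simp add: dot_def lp_duality_map_def)
  next
    case False
    have "- t * dot n h (lp_duality_map n p z) = dot n z (lp_duality_map n p z)"
      by (simp add: dot_def sum_distrib_left z mult_ac flip: sum_negf)
    then have "- t * dot n h (lp_duality_map n p z) = t * (t * (lp_norm n p h)\<^sup>2)"
      using p by (simp add: dot_lp_duality_map_self nz power2_eq_square)
    then have "t * (dot n h (lp_duality_map n p z) + t * (lp_norm n p h)\<^sup>2) = 0"
      by (simp add: algebra_simps)
    with False show ?thesis by (simp add: eq_neg_iff_add_eq_0)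
  qed
  moreover have "(lp_norm n p h)\<^sup>2 \<le> (p - 1) * (lp_norm n p h)\<^sup>2"
    using p by (intro mult_le_cancel_right1[THEN iffD2]) auto
  moreover have "((1 - t) * lp_norm n p h)\<^sup>2
      = (t * lp_norm n p h)\<^sup>2 + 2 * (- t * (lp_norm n p h)\<^sup>2) + (lp_norm n p h)\<^sup>2"
    by (simp add: power2_eq_square algebra_simps)
  ultimately show ?thesis by (simp add: nz nzh)
qed

lemma lp_norm_square_add_le:
  assumes p: "p \<ge> 2"
  shows "(lp_norm n p (z + h))\<^sup>2
    \<le> (lp_norm n p z)\<^sup>2 + 2 * dot n h (lp_duality_map n p z) + (p - 1) * (lp_norm n p h)\<^sup>2"
proof (cases "\<exists>t. 0 \<le> t \<and> t \<le> 1 \<and> (\<forall>i<n. z i + t * h i = 0)")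
  case True
  then show ?thesis using lp_norm_square_add_le_of_line_zero[OF p] by blast
next
  case False
  show ?thesis
  proof (cases "p = 2")
    case True
    have sq: "(lp_norm n 2 w)\<^sup>2 = (\<Sum>i<n. (w i)\<^sup>2)" for w
      by (simp add: lp_norm_square sum_nonneg)
    have "lp_norm n p z \<noteq> 0"
      using False[simplified, rule_format, of 0] by (auto simp: lp_norm_eq_0_iff)
    then have "dot n h (lp_duality_map n p z) = (\<Sum>i<n. h i * z i)"
      using True by (simp add: dot_def lp_duality_map_def sgn_mult_abs)
    then show ?thesis
      using True by (simp add: sq power2_sum sum.distrib sum_distrib_left mult_ac)
  next
    case False': False
    show ?thesis
      using False' p False by (intro lp_norm_square_add_le_of_line_nonzero) auto
  qed
qed

section \<open>The objective and the diameter\<close>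

lemma gradient_eq_lp_duality_map:
  assumes "p \<ge> 2" "i < n"
  shows "gradient n (half_sq_lp_dist n p xs) x i = lp_duality_map n p (x - xs) i"
  using assms by (simp add: gradient_half_sq_lp_dist lp_duality_map_def)

lemma dot_gradient_eq:
  assumes "p \<ge> 2"
  shows "dot n w (gradient n (half_sq_lp_dist n p xs) x) = dot n w (lp_duality_map n p (x - xs))"
  using assms by (simp add: dot_def gradient_eq_lp_duality_map)

lemma half_sq_lp_dist_smooth:
  assumes "p \<ge> 2"
  shows "half_sq_lp_dist n p xs (x + s *\<^sub>R d) \<le> half_sq_lp_dist n p xs x
    + s * dot n d (gradient n (half_sq_lp_dist n p xs) x)
    + s\<^sup>2 * ((p - 1) * (lp_norm n p d)\<^sup>2) / 2"
proof -
  have eq: "x + s *\<^sub>R d - xs = (x - xs) + s *\<^sub>R d" by simp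
  have "dot n (s *\<^sub>R d) w = s * dot n d w" for w
    by (simp add: dot_def scaleR_fun_def sum_distrib_left mult.assoc)
  then have "(lp_norm n p (x + s *\<^sub>R d - xs))\<^sup>2 \<le> (lp_norm n p (x - xs))\<^sup>2
      + 2 * (s * dot n d (lp_duality_map n p (x - xs))) + (p - 1) * (s\<^sup>2 * (lp_norm n p d)\<^sup>2)"
    using lp_norm_square_add_le[OF assms, of n "x - xs" "s *\<^sub>R d"] assms
    unfolding eq by (simp add: lp_norm_scaleR power_mult_distrib)
  then show ?thesis
    unfolding dot_gradient_eq[OF assms] half_sq_lp_dist_def by (simp add: mult_ac)
qed

text \<open>
  Compactness is needed for the greatest distance in the definition of the diameter to exist;
  without a greatest one that operator returns an unspecified value.
\<close>

lemma lp_norm_diff_le_lp_diameter: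
  assumes "compact C" "p > 0" "a \<in> C" "b \<in> C"
  shows "lp_norm n p (b - a) \<le> lp_diameter n p C"
proof -
  have cont: "continuous_on (C \<times> C) (\<lambda>w. lp_norm n p (snd w - fst w))"
  proof -
    have coord: "continuous_on (C \<times> C) (\<lambda>w. fst w i)" "continuous_on (C \<times> C) (\<lambda>w. snd w i)" for i :: nat
      by (rule continuous_on_product_then_coordinatewise[OF continuous_on_fst[OF continuous_on_id]],
          rule continuous_on_product_then_coordinatewise[OF continuous_on_snd[OF continuous_on_id]])
    show ?thesis
      unfolding lp_norm_def fun_diff_def using \<open>p > 0\<close>
      by (intro continuous_on_powr' continuous_intros coord) (auto intro: sum_nonneg)
  qed
  obtain w where w: "w \<in> C \<times> C"
    and max: "\<And>u. u \<in> C \<times> C \<Longrightarrow> lp_norm n p (snd u - fst u) \<le> lp_norm n p (snd w - fst w)"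
    using continuous_attains_sup[OF compact_Times[OF assms(1) assms(1)] _ cont] assms by blast
  have "lp_diameter n p C = lp_norm n p (snd w - fst w)"
    unfolding lp_diameter_def
    by (rule Greatest_equality) (use w max in force)+
  then show ?thesis using max[of "(a, b)"] assms by simp
qed

section \<open>Frank-Wolfe\<close>

lemma fw_iterates_in_domain:
  assumes "fw_run n C f x v \<gamma>" "convex C"
  shows "x t \<in> C"
proof (induction t)
  case 0
  then show ?case using assms by (simp add: fw_run_def extreme_point_of_def)
next
  case (Suc t)
  have "v t \<in> C" "0 \<le> \<gamma> t" "\<gamma> t \<le> 1" "x (Suc t) = (1 - \<gamma> t) *\<^sub>R x t + \<gamma> t *\<^sub>R v t"
    using assms by (auto simp: fw_run_def extreme_point_of_def algebra_simps)
  then show ?case using Suc assms(2) by (simp add: convex_alt del: plus_fun_apply)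
qed

lemma fw_cardinality_le: "fw_cardinality x0 v \<gamma> t \<le> t + 1"
proof -
  have "card {u. fw_weight x0 v \<gamma> t u > 0} \<le> card (insert x0 (v ` {..<t}))"
    using fw_weight_support[of x0 v \<gamma> t] by (intro card_mono) force+
  also have "\<dots> \<le> Suc (card (v ` {..<t}))" by (rule card_insert_le_m1) auto
  also have "\<dots> \<le> t + 1" using card_image_le[of "{..<t}" v] by simp
  finally show ?thesis by (simp add: fw_cardinality_def)
qed

text \<open>
  A convex quadratic with minimizer \<open>g / B\<close>, restricted to arguments at most \<open>1\<close>, is minimized by
  clipping. This is what makes the closed-loop step at least as good as any prescribed one.
\<close>

lemma clipped_step_minimizes_quadratic:
  fixes g B s :: real
  assumes "B > 0" "s \<le> 1"
  defines "\<gamma> \<equiv> min (g / B) 1"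
  shows "\<gamma>\<^sup>2 * B / 2 - \<gamma> * g \<le> s\<^sup>2 * B / 2 - s * g"
proof (cases "g / B \<le> 1")
  case True
  then have "g = \<gamma> * B" using assms by (simp add: \<gamma>_def)
  then have "(s\<^sup>2 * B / 2 - s * g) - (\<gamma>\<^sup>2 * B / 2 - \<gamma> * g) = B * (s - \<gamma>)\<^sup>2 / 2"
    by (simp add: power2_eq_square field_simps)
  also have "\<dots> \<ge> 0" using assms by simp
  finally show ?thesis by simp
next
  case False
  then have \<gamma>: "\<gamma> = 1" and g: "g > B" using assms by (simp_all add: \<gamma>_def field_simps)
  have "(1 - s) * (g - B) \<ge> 0" "B * (1 - s)\<^sup>2 \<ge> 0" using assms g by auto
  then show ?thesis by (simp add: \<gamma> power2_eq_square algebra_simps)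
qed

text \<open>
  Whichever strategy is run, its upper model of the next objective value is no larger than the one
  for the step \<open>2 / (t + 2)\<close>: for the open loop they coincide, and the closed loop minimizes the
  model. If \<open>v t = x t\<close>, the closed-loop strategy leaves the step unspecified, but then the model is
  constant; moreover the gap vanishes, so the iterate is already optimal.
\<close>

lemma fw_step_decrease:
  assumes p: "p \<ge> 2" and C: "C \<subseteq> Rn n" "compact C" "convex C" "xs \<in> C"
    and run: "fw_run n C (half_sq_lp_dist n p xs) x v \<gamma>"
    and step: "closed_loop n p (half_sq_lp_dist n p xs) x v \<gamma> \<or> open_loop \<gamma>"
  defines "h \<equiv> \<lambda>t. half_sq_lp_dist n p xs (x t)" and "s \<equiv> \<lambda>t::nat. 2 / (real t + 2)"
  shows "h (Suc t) \<le> (1 - s t) * h t + (s t)\<^sup>2 * ((p - 1) * (lp_diameter n p C)\<^sup>2 / 2)"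
proof -
  define grad where "grad = gradient n (half_sq_lp_dist n p xs) (x t)"
  define g where "g = dot n (x t - v t) grad"
  define B where "B = (p - 1) * (lp_norm n p (x t - v t))\<^sup>2"
  have xt: "x t \<in> C" and vt: "v t \<in> C"
    using fw_iterates_in_domain[OF run C(3)] run by (auto simp: fw_run_def extreme_point_of_def)
  have s: "0 < s t" "s t \<le> 1" by (auto simp: s_def)
  have dot_diff: "dot n (a - b) c = dot n a c - dot n b c" for a b c
    by (simp add: dot_def sum_subtractf algebra_simps)
  have h0: "h t \<ge> 0" by (simp add: h_def half_sq_lp_dist_def)
  have "2 * h t = dot n (x t - xs) grad"
    using p by (simp add: grad_def dot_gradient_eq dot_lp_duality_map_self h_def half_sq_lp_dist_def)
  also have "\<dots> \<le> g"
    using run C(4) by (simp add: g_def grad_def dot_diff fw_run_def)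
  finally have gap: "2 * h t \<le> g" .
  have "h (Suc t) \<le> h t + \<gamma> t * dot n (v t - x t) grad
      + (\<gamma> t)\<^sup>2 * ((p - 1) * (lp_norm n p (v t - x t))\<^sup>2) / 2"
    using half_sq_lp_dist_smooth[OF p, of n xs "x t" "\<gamma> t" "v t - x t"] run
    by (simp add: h_def grad_def fw_run_def)
  also have "dot n (v t - x t) grad = - g" by (simp add: g_def dot_diff)
  also have "lp_norm n p (v t - x t) = lp_norm n p (x t - v t)"
    by (simp add: lp_norm_def abs_minus_commute)
  finally have descent: "h (Suc t) \<le> h t + ((\<gamma> t)\<^sup>2 * B / 2 - \<gamma> t * g)"
    by (simp add: B_def)
  have "(\<gamma> t)\<^sup>2 * B / 2 - \<gamma> t * g \<le> (s t)\<^sup>2 * B / 2 - s t * g"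
  proof (cases "v t = x t")
    case True
    then have "g = 0" "B = 0"
      by (simp_all add: g_def B_def dot_def lp_norm_eq_0_iff)
    then show ?thesis by simp
  next
    case False
    have "B > 0"
    proof -
      obtain i where "v t i \<noteq> x t i" using False by auto
      moreover have "x t \<in> Rn n" "v t \<in> Rn n" using xt vt C(1) by auto
      ultimately have "i < n" "(x t - v t) i \<noteq> 0" by (auto simp: Rn_def not_less[symmetric]) metis
      then have "lp_norm n p (x t - v t) \<noteq> 0" by (auto simp: lp_norm_eq_0_iff)
      then show ?thesis using p by (simp add: B_def)
    qed
    show ?thesis
    proof (cases "open_loop \<gamma>")
      case True
      then show ?thesis by (simp add: open_loop_def s_def)
    next
      case False
      with step \<open>v t \<noteq> x t\<close> have "\<gamma> t = min (g / B) 1"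
        by (simp add: closed_loop_def g_def B_def grad_def)
      then show ?thesis
        using clipped_step_minimizes_quadratic[OF \<open>B > 0\<close> s(2), of g] by simp
    qed
  qed
  moreover have "(s t)\<^sup>2 * B / 2 \<le> (s t)\<^sup>2 * ((p - 1) * (lp_diameter n p C)\<^sup>2 / 2)"
  proof -
    have "(lp_norm n p (x t - v t))\<^sup>2 \<le> (lp_diameter n p C)\<^sup>2"
      using lp_norm_diff_le_lp_diameter[OF C(2) _ vt xt] p
      by (intro power_mono lp_norm_nonneg) auto
    then show ?thesis using p by (simp add: B_def mult_left_mono)
  qed
  moreover have "s t * h t \<le> s t * g"
    using s gap h0 by (intro mult_left_mono) auto
  ultimately have "h (Suc t) \<le> h t - s t * h t + (s t)\<^sup>2 * ((p - 1) * (lp_diameter n p C)\<^sup>2 / 2)"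
    using descent by linarith
  then show ?thesis by (simp add: left_diff_distrib)
qed

text \<open>
  The first step has size \<open>1\<close> and so forgets the initial value: the bound depends only on \<open>c\<close>.
  After that, the induction step comes down to \<open>(t + 2) (t + 4) \<le> (t + 3)\<^sup>2\<close>.
\<close>

lemma two_over_t_recursion_bound:
  fixes h :: "nat \<Rightarrow> real" and c :: real
  assumes "c \<ge> 0"
    and rec: "\<And>t. h (Suc t) \<le> (1 - 2 / (real t + 2)) * h t + (2 / (real t + 2))\<^sup>2 * c"
  shows "h (Suc t) \<le> 4 * c / (real t + 3)"
proof (induction t)
  case 0
  show ?case using rec[of 0] assms(1) by simp
next
  case (Suc t)
  define r where "r = real t"
  have r: "r \<ge> 0" by (simp add: r_def)
  have "h (Suc (Suc t)) \<le> (1 - 2 / (r + 3)) * h (Suc t) + (2 / (r + 3))\<^sup>2 * c"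
    using rec[of "Suc t"] by (simp add: r_def add_ac)
  also have "\<dots> \<le> (1 - 2 / (r + 3)) * (4 * c / (r + 3)) + (2 / (r + 3))\<^sup>2 * c"
    using Suc r by (intro add_right_mono mult_left_mono) (auto simp: r_def)
  also have "\<dots> = 4 * c * ((r + 2) / (r + 3)\<^sup>2)"
    using r by (simp add: divide_simps) (simp add: power2_eq_square algebra_simps)
  also have "\<dots> \<le> 4 * c * (1 / (r + 4))"
  proof (intro mult_left_mono)
    have "(r + 2) * (r + 4) \<le> (r + 3)\<^sup>2" by (simp add: power2_eq_square algebra_simps)
    then show "(r + 2) / (r + 3)\<^sup>2 \<le> 1 / (r + 4)" using r by (simp add: field_simps)
  qed (use assms(1) in simp)
  finally show ?case by (simp add: r_def add_ac)
qed

section \<open>Vertex-sparse approximation\<close>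

theorem corollary5p1:
  shows "\<exists>K::real. K > 0 \<and>
    (\<forall>(n::nat) (C :: vec set) (xs :: vec) (p::real) (\<epsilon>::real)
        (x :: nat \<Rightarrow> vec) (v :: nat \<Rightarrow> vec) (\<gamma> :: nat \<Rightarrow> real).
      C \<subseteq> Rn n \<and> C \<noteq> {} \<and> compact C \<and> convex C \<and> xs \<in> C \<and> p \<ge> 2 \<and> \<epsilon> > 0 \<and>
      fw_run n C (half_sq_lp_dist n p xs) x v \<gamma> \<and>
      (closed_loop n p (half_sq_lp_dist n p xs) x v \<gamma> \<or> open_loop \<gamma>) \<longrightarrow>
      (\<exists>t. x t \<in> C \<and> lp_norm n p (x t - xs) \<le> \<epsilon> \<and>
        real (fw_cardinality (x 0) v \<gamma> t)
          \<le> K * max 1 (p * (lp_diameter n p C)\<^sup>2 / \<epsilon>\<^sup>2)))"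
\<comment> \<open>With \<open>M = p D\<^sup>2 / \<epsilon>\<^sup>2\<close>, the iterate of index \<open>\<lceil>4 M\<rceil> + 1\<close> is accurate enough and has
  at most \<open>\<lceil>4 M\<rceil> + 2 \<le> 4 M + 3\<close> vertices, which is at most \<open>7 max 1 M\<close>.\<close>
proof (rule exI[of _ 7], intro conjI allI impI; (elim conjE)?)
  fix n :: nat and C :: "vec set" and xs :: vec and p \<epsilon> :: real
    and x v :: "nat \<Rightarrow> vec" and \<gamma> :: "nat \<Rightarrow> real"
  assume C: "C \<subseteq> Rn n" "compact C" "convex C" "xs \<in> C" and p: "p \<ge> 2" and eps: "\<epsilon> > 0"
    and run: "fw_run n C (half_sq_lp_dist n p xs) x v \<gamma>"
    and step: "closed_loop n p (half_sq_lp_dist n p xs) x v \<gamma> \<or> open_loop \<gamma>"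
  define D where "D = lp_diameter n p C"
  define M where "M = p * D\<^sup>2 / \<epsilon>\<^sup>2"
  define k where "k = nat \<lceil>4 * M\<rceil>"
  have "M \<ge> 0" using p by (simp add: M_def)
  then have k: "4 * M \<le> real k" "real k < 4 * M + 1"
    by (auto simp: k_def) linarith+
  have "half_sq_lp_dist n p xs (x (Suc k)) \<le> 4 * ((p - 1) * D\<^sup>2 / 2) / (real k + 3)"
    using fw_step_decrease[OF p C run step] p
    by (intro two_over_t_recursion_bound) (auto simp: D_def)
  also have "\<dots> \<le> \<epsilon>\<^sup>2 / 2"
  proof -
    have "4 * (p * D\<^sup>2) \<le> real k * \<epsilon>\<^sup>2"
      using k(1) eps by (simp add: M_def field_simps)
    moreover have "(p - 1) * D\<^sup>2 \<le> p * D\<^sup>2" by (intro mult_right_mono) auto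
    ultimately have "4 * ((p - 1) * D\<^sup>2) \<le> (real k + 3) * \<epsilon>\<^sup>2"
      using zero_le_power2[of \<epsilon>] unfolding distrib_right by linarith
    then show ?thesis by (simp add: field_simps)
  qed
  finally have "(lp_norm n p (x (Suc k) - xs))\<^sup>2 \<le> \<epsilon>\<^sup>2"
    by (simp add: half_sq_lp_dist_def)
  then have "lp_norm n p (x (Suc k) - xs) \<le> \<epsilon>"
    by (rule power2_le_imp_le) (use eps in simp)
  moreover have "real (fw_cardinality (x 0) v \<gamma> (Suc k)) \<le> 7 * max 1 M"
  proof -
    have "real (fw_cardinality (x 0) v \<gamma> (Suc k)) \<le> real k + 2"
      using fw_cardinality_le[of "x 0" v \<gamma> "Suc k"] by linarith
    then show ?thesis using k by linarith
  qed
  moreover have "x (Suc k) \<in> C" by (rule fw_iterates_in_domain[OF run C(3)])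
  ultimately show "\<exists>t. x t \<in> C \<and> lp_norm n p (x t - xs) \<le> \<epsilon> \<and>
      real (fw_cardinality (x 0) v \<gamma> t) \<le> 7 * max 1 (p * (lp_diameter n p C)\<^sup>2 / \<epsilon>\<^sup>2)"
    unfolding M_def D_def by blast
qed simp

end
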